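(* Let $n\ge1$ be an integer. The group $\mathrm{Isom}\,\mathbb{R}\mathbf{P}_n$ (acting on $\mathbb{R}\mathbf{P}_n$) is fixating if and only if $n=1$. The group $\mathrm{Isom}^+\,\mathbb{R}\mathbf{P}_n$ (acting on $\mathbb{R}\mathbf{P}_n$) is fixating if $n=1$, and is not fixating if $n$ is odd and $n\ge5$.
   Context: $\mathbb{R}\mathbf{P}_n$ is the quotient of the unit sphere $\mathbb{S}_n\subset\mathbb{R}^{n+1}$ by the relation identifying $x$ and $-x$, with the distance $d(\{x,-x\},\{y,-y\})=\arccos|\langle x\,|\,y\rangle|$. $\mathrm{Isom}\,\mathbb{R}\mathbf{P}_n$ is the group of its isometries (distance-preserving bijections). Each isometry $f$ of $\mathbb{S}_n$ (i.e. restriction to $\mathbb{S}_n$ of an element of $\mathrm{O}_{n+1}$) induces an isometry $\psi(f):\{x,-x\}\mapsto\{f(x),-f(x)\}$ of $\mathbb{R}\mathbf{P}_n$; the morphism $\psi$ is onto $\mathrm{Isom}\,\mathbb{R}\mathbf{P}_n$ with kernel $\{\pm\mathrm{id}\}$. $\mathrm{Isom}^+\,\mathbb{R}\mathbf{P}_n$ is the image under $\psi$ of $\mathrm{Isom}^+\,\mathbb{S}_n$, the group of restrictions to $\mathbb{S}_n$ of elements of $\mathrm{SO}_{n+1}$. For a bijection $g$ of a set $X$, $\mathrm{Fix}\,g=\{x\in X: g(x)=x\}$. A group $H$ of bijections of $X$ is a GAF if $\mathrm{Fix}\,g\neq\emptyset$ for every $g\in H$; it is a GAG if $\bigcap_{g\in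 H}\mathrm{Fix}\,g\ne\emptyset$. A group $G$ of bijections of $X$ is fixating if every subgroup of $G$ that is a GAF is a GAG. *)

theory Defs
  imports "HOL-Analysis.Analysis" "HOL-Algebra.Bij"
begin

section \<open>Fixating groups of bijections\<close>

text \<open>
  A group of bijections of \<open>X\<close> is a subgroup \<open>G\<close> of \<^term>\<open>BijGroup X\<close>; its elements are
  extensional functions, so distinct elements differ at some point of \<open>X\<close>.
\<close>

definition Fix :: "'a set \<Rightarrow> ('a \<Rightarrow> 'a) \<Rightarrow> 'a set" where
  "Fix X g = {x \<in> X. g x = x}"

definition GAF :: "'a set \<Rightarrow> ('a \<Rightarrow> 'a) set \<Rightarrow> bool" where
  "GAF X H \<longleftrightarrow> (\<forall>g\<in>H. Fix X g \<noteq> {})"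

definition GAG :: "'a set \<Rightarrow> ('a \<Rightarrow> 'a) set \<Rightarrow> bool" where
  "GAG X H \<longleftrightarrow> (\<Inter>g\<in>H. Fix X g) \<noteq> {}"

definition fixating :: "'a set \<Rightarrow> ('a \<Rightarrow> 'a) set \<Rightarrow> bool" where
  "fixating X G \<longleftrightarrow>
    (\<forall>H. subgroup H (BijGroup X\<lparr>carrier := G\<rparr>) \<longrightarrow> GAF X H \<longrightarrow> GAG X H)"


section \<open>Real projective space and its isometries\<close>

text \<open>
  The index type \<open>'d\<close> has \<open>n + 1\<close> elements for the projective space of dimension \<open>n\<close>.
\<close>

definition antipodal :: "((real^'d) \<times> (real^'d)) set" where
  "antipodal = {(x, y). x \<in> sphere 0 1 \<and> y \<in> sphere 0 1 \<and> (y = x \<or> y = - x)}"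

definition RP :: "(real^'d) set set" where
  "RP = sphere 0 1 // antipodal"

text \<open>
  The value is independent of the chosen representatives; see \<open>dist_RP_eq\<close> below.
\<close>

definition dist_RP :: "(real^'d) set \<Rightarrow> (real^'d) set \<Rightarrow> real" where
  "dist_RP P Q = (THE r. \<exists>x\<in>P. \<exists>y\<in>Q. r = arccos \<bar>x \<bullet> y\<bar>)"

definition Isom_RP :: "((real^'d) set \<Rightarrow> (real^'d) set) set" where
  "Isom_RP = {g \<in> Bij RP. \<forall>P\<in>RP. \<forall>Q\<in>RP. dist_RP (g P) (g Q) = dist_RP P Q}"

definition Isom_plus_sphere :: "(real^'d \<Rightarrow> real^'d) set" where
  "Isom_plus_sphere = {restrict ((*v) A) (sphere 0 1) | A. rotation_matrix A}"

definition psi :: "(real^'d \<Rightarrow> real^'d) \<Rightarrow> (real^'d) set \<Rightarrow> (real^'d) set" where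
  "psi f = (\<lambda>P\<in>RP. f ` P)"

definition Isom_plus_RP :: "((real^'d) set \<Rightarrow> (real^'d) set) set" where
  "Isom_plus_RP = psi ` Isom_plus_sphere"


section \<open>Well-definedness\<close>

lemma equiv_antipodal: "equiv (sphere 0 1) (antipodal :: ((real^'d) \<times> (real^'d)) set)"
  by (rule equivI) (auto simp: antipodal_def refl_on_def sym_def trans_def)

lemma RP_eq: "(RP :: (real^'d) set set) = {{x, - x} | x. x \<in> sphere 0 1}"
proof -
  have "antipodal `` {x} = {x, - x}" if "x \<in> sphere 0 1" for x :: "real^'d"
    using that by (auto simp: antipodal_def)
  then show ?thesis
    unfolding RP_def quotient_def by auto
qed

lemma dist_RP_eq: "dist_RP {x, - x} {y, - y} = arccos \<bar>x \<bullet> y\<bar>"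
  unfolding dist_RP_def by (rule the_equality) auto

lemma subgroup_Isom_RP: "subgroup Isom_RP (BijGroup (RP :: (real^'d) set set))"
proof -
  let ?X = "RP :: (real^'d) set set"
  interpret B: group "BijGroup ?X" by (rule group_BijGroup)
  have maps: "g P \<in> ?X" if "g \<in> Bij ?X" "P \<in> ?X" for g P
    using that Bij_imp_funcset by blast
  show ?thesis
  proof (rule B.subgroupI)
    show "Isom_RP \<subseteq> carrier (BijGroup ?X)"
      by (auto simp: Isom_RP_def BijGroup_def)
    have "(\<lambda>x\<in>?X. x) \<in> Isom_RP"
      by (simp add: Isom_RP_def id_Bij)
    then show "(Isom_RP :: ((real^'d) set \<Rightarrow> _) set) \<noteq> {}" by blast
  next
    fix g h :: "(real^'d) set \<Rightarrow> (real^'d) set"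
    assume "g \<in> Isom_RP" "h \<in> Isom_RP"
    then show "g \<otimes>\<^bsub>BijGroup ?X\<^esub> h \<in> Isom_RP"
      by (auto simp: Isom_RP_def BijGroup_def compose_Bij compose_eq maps)
  next
    fix g :: "(real^'d) set \<Rightarrow> (real^'d) set"
    assume g: "g \<in> Isom_RP"
    then have gB: "g \<in> Bij ?X" by (simp add: Isom_RP_def)
    have inv_eq: "inv\<^bsub>BijGroup ?X\<^esub> g = (\<lambda>x\<in>?X. inv_into ?X g x)"
      by (rule inv_BijGroup[OF gB])
    have im: "g ` ?X = ?X" using gB by (simp add: Bij_def bij_betw_def)
    have "dist_RP (inv_into ?X g P) (inv_into ?X g Q) = dist_RP P Q" if "P \<in> ?X" "Q \<in> ?X" for P Q
    proof -
      have "inv_into ?X g P \<in> ?X" "inv_into ?X g Q \<in> ?X"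
        using that gB by (auto intro: Bij_inv_into_mem)
      then have "dist_RP (g (inv_into ?X g P)) (g (inv_into ?X g Q))
          = dist_RP (inv_into ?X g P) (inv_into ?X g Q)"
        using g by (simp add: Isom_RP_def)
      then show ?thesis using that im by (simp add: f_inv_into_f)
    qed
    then show "inv\<^bsub>BijGroup ?X\<^esub> g \<in> Isom_RP"
      using gB by (simp add: Isom_RP_def inv_eq restrict_inv_into_Bij)
  qed
qed

lemma psi_eq:
  fixes A :: "real^'d^'d"
  assumes "x \<in> sphere 0 1"
  shows "psi (restrict ((*v) A) (sphere 0 1)) {x, - x} = {A *v x, - (A *v x)}"
proof -
  have "{x, - x} \<in> RP" using assms by (auto simp: RP_eq)
  moreover have "A *v (- x) = - (A *v x)"
    using linear_neg[OF matrix_vector_mul_linear] by blast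
  ultimately show ?thesis using assms by (simp add: psi_def)
qed

lemma psi_in_Isom_RP:
  fixes A :: "real^'d^'d"
  assumes A: "orthogonal_matrix A"
  shows "psi (restrict ((*v) A) (sphere 0 1)) \<in> Isom_RP"
proof -
  let ?p = "\<lambda>A::real^'d^'d. psi (restrict ((*v) A) (sphere 0 1))"
  have ot: "orthogonal_transformation ((*v) B)" if "orthogonal_matrix B" for B :: "real^'d^'d"
    using that by (simp add: orthogonal_transformation_matrix)
  have maps: "?p B P \<in> RP" if "orthogonal_matrix B" "P \<in> RP" for B P
    using that ot[OF that(1)] by (auto simp: RP_eq psi_eq orthogonal_transformation)
  have canc: "?p (B ** C) P = ?p B (?p C P)" if "orthogonal_matrix C" "P \<in> RP" for B C P
    using that ot[OF that(1)]
    by (auto simp: RP_eq psi_eq orthogonal_transformation matrix_vector_mul_assoc)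
  have one: "?p (mat 1) P = P" if "P \<in> RP" for P
    using that by (auto simp: RP_eq psi_eq)
  have A': "orthogonal_matrix (transpose A)" using A by simp
  have "bij_betw (?p A) RP RP"
    by (rule bij_betwI[where g = "?p (transpose A)"])
       (use A A' in \<open>auto simp: maps canc[symmetric] one orthogonal_matrix_def\<close>)
  moreover have "dist_RP (?p A P) (?p A Q) = dist_RP P Q" if "P \<in> RP" "Q \<in> RP" for P Q
    using that ot[OF A] by (auto simp: RP_eq psi_eq dist_RP_eq orthogonal_transformation_def)
  ultimately show ?thesis
    by (simp add: Isom_RP_def Bij_def psi_def)
qed

lemma subgroup_Isom_plus_RP: "subgroup Isom_plus_RP (BijGroup (RP :: (real^'d) set set))"
proof -
  let ?X = "RP :: (real^'d) set set"
  let ?p = "\<lambda>A::real^'d^'d. psi (restrict ((*v) A) (sphere 0 1))"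
  interpret B: group "BijGroup ?X" by (rule group_BijGroup)
  have Isom_plus: "Isom_plus_RP = {?p A | A. rotation_matrix A}"
    by (auto simp: Isom_plus_RP_def Isom_plus_sphere_def)
  have inB: "?p A \<in> Bij ?X" if "rotation_matrix A" for A
    using that psi_in_Isom_RP[of A] by (simp add: rotation_matrix_def Isom_RP_def)
  have mult: "?p A \<otimes>\<^bsub>BijGroup ?X\<^esub> ?p C = ?p (A ** C)"
    if "rotation_matrix A" "rotation_matrix C" for A C
  proof -
    have "compose ?X (?p A) (?p C) P = ?p (A ** C) P" for P
    proof (cases "P \<in> ?X")
      case True
      then obtain x where x: "P = {x, - x}" "x \<in> sphere 0 1" by (auto simp: RP_eq)
      have "C *v x \<in> sphere 0 1"
        using that(2) x(2) orthogonal_transformation_matrix[of "(*v) C"]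
        by (simp add: rotation_matrix_def orthogonal_transformation)
      with True x show ?thesis
        by (simp add: compose_eq psi_eq matrix_vector_mul_assoc)
    qed (simp add: compose_def psi_def)
    then show ?thesis using that inB by (auto simp: BijGroup_def)
  qed
  have one: "?p (mat 1) = \<one>\<^bsub>BijGroup ?X\<^esub>"
  proof
    show "?p (mat 1) P = \<one>\<^bsub>BijGroup ?X\<^esub> P" for P
    proof (cases "P \<in> ?X")
      case True
      then obtain x where "P = {x, - x}" "x \<in> sphere 0 1" by (auto simp: RP_eq)
      with True show ?thesis by (simp add: BijGroup_def psi_eq)
    qed (simp add: BijGroup_def psi_def)
  qed
  have rot_mult: "rotation_matrix (A ** C)" if "rotation_matrix A" "rotation_matrix C"
    for A C :: "real^'d^'d"
    using that by (simp add: rotation_matrix_def orthogonal_matrix_mul det_mul)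
  have rot_one: "rotation_matrix (mat 1 :: real^'d^'d)"
    by (simp add: rotation_matrix_def orthogonal_matrix_id)
  have rot_tr: "rotation_matrix (transpose A)" if "rotation_matrix A" for A :: "real^'d^'d"
    using that by (simp add: rotation_matrix_def det_transpose)
  show ?thesis
  proof (rule B.subgroupI)
    show "Isom_plus_RP \<subseteq> carrier (BijGroup ?X)"
      using inB by (auto simp: Isom_plus BijGroup_def)
    show "(Isom_plus_RP :: ((real^'d) set \<Rightarrow> _) set) \<noteq> {}"
      using rot_one by (auto simp: Isom_plus)
  next
    fix g h :: "(real^'d) set \<Rightarrow> (real^'d) set"
    assume "g \<in> Isom_plus_RP" "h \<in> Isom_plus_RP"
    then show "g \<otimes>\<^bsub>BijGroup ?X\<^esub> h \<in> Isom_plus_RP"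
      using mult rot_mult by (auto simp: Isom_plus)
  next
    fix g :: "(real^'d) set \<Rightarrow> (real^'d) set"
    assume "g \<in> Isom_plus_RP"
    then obtain A where A: "g = ?p A" "rotation_matrix A" by (auto simp: Isom_plus)
    have "?p (transpose A) \<otimes>\<^bsub>BijGroup ?X\<^esub> ?p A = \<one>\<^bsub>BijGroup ?X\<^esub>"
      using A(2) by (simp add: mult rot_tr one[symmetric]) (simp add: rotation_matrix_def orthogonal_matrix_def)
    then have "inv\<^bsub>BijGroup ?X\<^esub> (?p A) = ?p (transpose A)"
      using inB[OF A(2)] inB[OF rot_tr[OF A(2)]] by (intro B.inv_equality) (auto simp: BijGroup_def)
    then show "inv\<^bsub>BijGroup ?X\<^esub> g \<in> Isom_plus_RP"
      using A rot_tr by (auto simp: Isom_plus)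
  qed
qed

end

theory Submission
  imports Defs
begin

text \<open>
  On the projective line the statement is elementary geometry. Only two points are equidistant from
  two given distinct points, and these midpoints of the two arcs are at distance \<open>\<pi>/2\<close> from each
  other (\<open>RP_line_equidistant\<close>). Consequently a non-identical isometry with a fixed point
  fixes exactly that point and its perpendicular. If \<open>g\<close> is such an isometry in a group where everything has a fixed point, and \<open>h\<close> is any other
  element, then a fixed point of \<open>g \<circ> h\<close> forces the fixed points of \<open>g\<close> and \<open>h\<close> onto a single
  perpendicular pair, so every \<open>h\<close> fixes the points that \<open>g\<close> fixes.

  In higher dimension \<open>n\<close> the counterexamples are the projective images of groups of orthogonal
  matrices in which every matrix has a real eigenvector but no line is invariant under all of them
  (\<open>not_fixating_by_matrices\<close>).

  For \<open>n + 1 \<ge> 3\<close>, \<open>n + 1 \<noteq> 4\<close>, such a group is formed by the rotations that preserve the span of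
  three coordinate axes, and hence its orthogonal complement. Odd-dimensional orthogonal maps have
  a real eigenvector, so every element has one in the span. On the other hand sign changes of pairs
  of coordinates leave no invariant lines except the coordinate axes, and the quarter turns of
  coordinate planes inside one of the two blocks move these. The last point uses that neither block
  has dimension one, which is what fails for \<open>n = 3\<close>.

  For \<open>n = 3\<close> there is a group that contains improper isometries. On the space of dimension
  \<open>2 + 2\<close> let \<open>K\<close> be a reflection plus a quarter turn, and let \<open>M\<close> swap the coordinates in both
  blocks. These anticommute, and the group consists of the orthogonal matrices commuting up to sign
  with both. Each sign pattern for a matrix \<open>A\<close> makes \<open>A\<close> commute with enough products of \<open>K\<close> and
  \<open>M\<close> to preserve a one-dimensional eigenspace, while \<open>K\<close> and \<open>M\<close> have no common eigenvector.
\<close>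

section \<open>Isometries of the projective line\<close>

lemma RP_cases:
  assumes "P \<in> RP"
  obtains x where "norm x = 1" "P = {x, - x}"
  using assms by (auto simp: RP_eq)

lemma RP_I: "norm x = 1 \<Longrightarrow> {x, - x} \<in> RP"
  by (auto simp: RP_eq)

lemma dist_RP_eq_iff:
  fixes x y z w :: "real^'d"
  assumes "norm x = 1" "norm y = 1" "norm z = 1" "norm w = 1"
  shows "dist_RP {x, - x} {y, - y} = dist_RP {z, - z} {w, - w} \<longleftrightarrow> \<bar>x \<bullet> y\<bar> = \<bar>z \<bullet> w\<bar>"
proof -
  have "\<bar>x \<bullet> y\<bar> \<le> 1" "\<bar>z \<bullet> w\<bar> \<le> 1"
    using Cauchy_Schwarz_ineq2[of x y] Cauchy_Schwarz_ineq2[of z w] assms by auto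
  then show ?thesis by (simp add: dist_RP_eq arccos_eq_iff)
qed

lemma dist_RP_eq_right_angle_iff:
  fixes x y :: "real^'d"
  assumes "norm x = 1" "norm y = 1"
  shows "dist_RP {x, - x} {y, - y} = pi / 2 \<longleftrightarrow> x \<bullet> y = 0"
proof -
  have "\<bar>x \<bullet> y\<bar> \<le> 1"
    using Cauchy_Schwarz_ineq2[of x y] assms by auto
  then have "arccos \<bar>x \<bullet> y\<bar> = arccos 0 \<longleftrightarrow> x \<bullet> y = 0"
    by (subst arccos_eq_iff) auto
  then show ?thesis by (simp add: dist_RP_eq)
qed

lemma plane_orthogonal_parallel:
  fixes a x y :: "real^'d"
  assumes d: "CARD('d) = 2" and "a \<noteq> 0" "y \<noteq> 0" and xa: "x \<bullet> a = 0" and ya: "y \<bullet> a = 0"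
  obtains c where "x = c *\<^sub>R y"
proof -
  obtain i j :: 'd where ij: "UNIV = {i, j}" "i \<noteq> j" using d by (auto simp: card_2_iff)
  have inn: "v \<bullet> w = v$i * w$i + v$j * w$j" for v w :: "real^'d"
    unfolding inner_vec_def ij(1) using ij(2) by simp
  have ext: "v = w \<longleftrightarrow> v$i = w$i \<and> v$j = w$j" for v w :: "real^'d"
  proof -
    have "(\<forall>k\<in>UNIV. v$k = w$k) \<longleftrightarrow> v$i = w$i \<and> v$j = w$j" unfolding ij(1) by simp
    then show ?thesis by (simp add: vec_eq_iff)
  qed
  have a0: "a$i \<noteq> 0 \<or> a$j \<noteq> 0" using \<open>a \<noteq> 0\<close> by (simp add: ext)
  have "a$i * (x$i * y$j - x$j * y$i) = 0" "a$j * (x$i * y$j - x$j * y$i) = 0"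
  proof -
    have "a$i * (x$i * y$j - x$j * y$i) = (x \<bullet> a) * y$j - (y \<bullet> a) * x$j"
      "a$j * (x$i * y$j - x$j * y$i) = (y \<bullet> a) * x$i - (x \<bullet> a) * y$i"
      by (simp_all add: inn algebra_simps)
    then show "a$i * (x$i * y$j - x$j * y$i) = 0" "a$j * (x$i * y$j - x$j * y$i) = 0"
      by (simp_all add: xa ya)
  qed
  with a0 have cr: "x$i * y$j = x$j * y$i" by auto
  have "x = ((x \<bullet> y) / (y \<bullet> y)) *\<^sub>R y"
  proof -
    have "y \<bullet> y \<noteq> 0" using \<open>y \<noteq> 0\<close> by simp
    moreover have "x$i * (y \<bullet> y) - (x \<bullet> y) * y$i = y$j * (x$i * y$j - x$j * y$i)"
      "x$j * (y \<bullet> y) - (x \<bullet> y) * y$j = - y$i * (x$i * y$j - x$j * y$i)"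
      by (simp_all add: inn algebra_simps)
    then have "x$i * (y \<bullet> y) = (x \<bullet> y) * y$i" "x$j * (y \<bullet> y) = (x \<bullet> y) * y$j"
      by (simp_all add: cr)
    ultimately show ?thesis by (simp add: ext nonzero_eq_divide_eq)
  qed
  then show thesis by (rule that)
qed

text \<open>The kernel of a nonzero linear form on the plane is a line, so it contains one point of the
  projective line.\<close>

lemma plane_orthogonal_unit_unique:
  fixes a x y :: "real^'d"
  assumes "CARD('d) = 2" "norm x = 1" "norm y = 1" "a \<noteq> 0" "x \<bullet> a = 0" "y \<bullet> a = 0"
  shows "{x, - x} = {y, - y}"
proof -
  have "y \<noteq> 0" using assms(3) by auto
  then obtain c where c: "x = c *\<^sub>R y"
    by (rule plane_orthogonal_parallel[OF assms(1,4) _ assms(5,6)])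
  with assms have "\<bar>c\<bar> = 1" by simp
  then have "c = 1 \<or> c = - 1" by linarith
  with c show ?thesis by auto
qed

lemma RP_line_perp_unique:
  fixes P Q R :: "(real^'d) set"
  assumes d: "CARD('d) = 2" and "P \<in> RP" "Q \<in> RP" "R \<in> RP"
    and "dist_RP Q P = pi / 2" "dist_RP R P = pi / 2"
  shows "Q = R"
proof -
  obtain p where p: "norm p = 1" "P = {p, - p}" by (rule RP_cases[OF assms(2)])
  obtain q where q: "norm q = 1" "Q = {q, - q}" by (rule RP_cases[OF assms(3)])
  obtain r where r: "norm r = 1" "R = {r, - r}" by (rule RP_cases[OF assms(4)])
  note * = p(1) q(1) r(1) and eq = p(2) q(2) r(2)
  have "q \<bullet> p = 0" "r \<bullet> p = 0"
    using assms(5,6) dist_RP_eq_right_angle_iff[OF *(2,1)] dist_RP_eq_right_angle_iff[OF *(3,1)]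
    unfolding eq by blast+
  moreover have "p \<noteq> 0" using * by auto
  ultimately show ?thesis
    using plane_orthogonal_unit_unique[OF d, of q r p] * eq by simp
qed

text \<open>The points equidistant from \<open>{x, -x}\<close> and \<open>{y, -y}\<close> are the lines orthogonal to \<open>x - y\<close> or
  to \<open>x + y\<close>. These two vectors are nonzero and mutually orthogonal, so in the plane there are just
  two such lines, and they are perpendicular to each other.\<close>

lemma RP_line_equidistant:
  fixes X Y P Q :: "(real^'d) set"
  assumes d: "CARD('d) = 2" and "X \<in> RP" "Y \<in> RP" "P \<in> RP" "Q \<in> RP" and "X \<noteq> Y"
    and "dist_RP P X = dist_RP P Y" "dist_RP Q X = dist_RP Q Y"
  shows "Q = P \<or> dist_RP Q P = pi / 2"
proof -
  obtain x where x: "norm x = 1" "X = {x, - x}" by (rule RP_cases[OF assms(2)])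
  obtain y where y: "norm y = 1" "Y = {y, - y}" by (rule RP_cases[OF assms(3)])
  obtain p where p: "norm p = 1" "P = {p, - p}" by (rule RP_cases[OF assms(4)])
  obtain q where q: "norm q = 1" "Q = {q, - q}" by (rule RP_cases[OF assms(5)])
  note n = x(1) y(1) p(1) q(1) and eq = x(2) y(2) p(2) q(2)
  define u w where "u = x - y" and "w = x + y"
  have "x \<noteq> y" "x \<noteq> - y" using \<open>X \<noteq> Y\<close> unfolding eq by auto
  then have u0: "u \<noteq> 0" and w0: "w \<noteq> 0"
    by (auto simp: u_def w_def eq_neg_iff_add_eq_0)
  have uw: "u \<bullet> w = 0"
    using n by (simp add: u_def w_def inner_diff_left inner_add_right inner_commute[of y x] dot_square_norm)
  have alt: "v \<bullet> u = 0 \<or> v \<bullet> w = 0" if "norm v = 1" "dist_RP {v, - v} X = dist_RP {v, - v} Y" for v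
  proof -
    have "\<bar>v \<bullet> x\<bar> = \<bar>v \<bullet> y\<bar>" using that n by (simp add: eq dist_RP_eq_iff)
    then have "v \<bullet> x = v \<bullet> y \<or> v \<bullet> x = - (v \<bullet> y)" by linarith
    then show ?thesis by (auto simp: u_def w_def inner_diff_right inner_add_right)
  qed
  have pu: "p \<bullet> u = 0 \<or> p \<bullet> w = 0" and qu: "q \<bullet> u = 0 \<or> q \<bullet> w = 0"
    using alt n assms(7,8) by (simp_all add: eq)
  have perp: "s \<bullet> t = 0" if st: "s \<bullet> a = 0" "t \<bullet> b = 0" "a \<bullet> b = 0" "a \<noteq> 0" "b \<noteq> 0"
    for s t a b :: "real^'d"
  proof -
    obtain c where "s = c *\<^sub>R b"
      using plane_orthogonal_parallel[OF d \<open>a \<noteq> 0\<close> \<open>b \<noteq> 0\<close> \<open>s \<bullet> a = 0\<close>] st(3) inner_commute[of b a]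
      by auto
    then show ?thesis using st by (simp add: inner_commute)
  qed
  consider "p \<bullet> u = 0" "q \<bullet> u = 0" | "p \<bullet> w = 0" "q \<bullet> w = 0" | "p \<bullet> u = 0" "q \<bullet> w = 0"
    | "p \<bullet> w = 0" "q \<bullet> u = 0"
    using pu qu by blast
  then show ?thesis
  proof cases
    case 1
    then show ?thesis using plane_orthogonal_unit_unique[OF d _ _ u0] n eq by blast
  next
    case 2
    then show ?thesis using plane_orthogonal_unit_unique[OF d _ _ w0] n eq by blast
  next
    case 3
    then have "q \<bullet> p = 0" using perp[of p u q w] u0 w0 uw by (simp add: inner_commute)
    then show ?thesis using dist_RP_eq_right_angle_iff[OF n(4,3)] unfolding eq by blast
  next
    case 4
    then have "q \<bullet> p = 0" using perp[of q u p w] u0 w0 uw by (simp add: inner_commute)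
    then show ?thesis using dist_RP_eq_right_angle_iff[OF n(4,3)] unfolding eq by blast
  qed
qed

lemma Isom_RP_maps: "g \<in> Isom_RP \<Longrightarrow> P \<in> RP \<Longrightarrow> g P \<in> RP"
  unfolding Isom_RP_def using Bij_imp_funcset by blast

lemma Isom_RP_dist:
  "g \<in> Isom_RP \<Longrightarrow> P \<in> RP \<Longrightarrow> Q \<in> RP \<Longrightarrow> dist_RP (g P) (g Q) = dist_RP P Q"
  by (simp add: Isom_RP_def)

text \<open>The perpendicular of \<open>P\<close> is the only point at distance \<open>\<pi>/2\<close> from \<open>P\<close>, so an isometry that
  fixes \<open>P\<close> has no other choice for its image.\<close>

lemma RP_line_fixes_perp:
  fixes g :: "(real^'d) set \<Rightarrow> (real^'d) set"
  assumes d: "CARD('d) = 2" and g: "g \<in> Isom_RP" and P: "P \<in> RP" "g P = P"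
    and Q: "Q \<in> RP" "dist_RP Q P = pi / 2"
  shows "g Q = Q"
  using RP_line_perp_unique[OF d P(1) Isom_RP_maps[OF g Q(1)] Q(1)] Isom_RP_dist[OF g Q(1) P(1)] P Q
  by simp

text \<open>Fixed points of \<open>g\<close> are equidistant from \<open>X\<close> and \<open>g X\<close>, so one moved point \<open>X\<close> already
  confines them to a perpendicular pair.\<close>

lemma RP_line_two_fixed_points:
  fixes g :: "(real^'d) set \<Rightarrow> (real^'d) set"
  assumes d: "CARD('d) = 2" and g: "g \<in> Isom_RP" and P: "P \<in> RP" "g P = P"
    and R: "R \<in> RP" "g R = R" and X: "X \<in> RP" "g X \<noteq> X"
  shows "R = P \<or> dist_RP R P = pi / 2"
proof (rule RP_line_equidistant[OF d X(1) Isom_RP_maps[OF g X(1)] P(1) R(1)])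
  show "X \<noteq> g X" using X by simp
  show "dist_RP P X = dist_RP P (g X)" using Isom_RP_dist[OF g P(1) X(1)] P by simp
  show "dist_RP R X = dist_RP R (g X)" using Isom_RP_dist[OF g R(1) X(1)] R by simp
qed

theorem fixating_Isom_RP_line:
  assumes d: "CARD('d::finite) = 2"
  shows "fixating (RP :: (real^'d) set set) Isom_RP"
  unfolding fixating_def
proof (intro allI impI)
  let ?X = "RP :: (real^'d) set set"
  fix H assume H: "subgroup H (BijGroup ?X\<lparr>carrier := Isom_RP\<rparr>)" and gaf: "GAF ?X H"
  interpret B: group "BijGroup ?X" by (rule group_BijGroup)
  have HI: "H \<subseteq> Isom_RP" using subgroup.subset[OF H] by simp
  have HB: "subgroup H (BijGroup ?X)"
    by (rule B.incl_subgroup[OF subgroup_Isom_RP H])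
  have fp: "\<exists>P\<in>RP. g P = P" if "g \<in> H" for g
    using gaf that by (auto simp: GAF_def Fix_def)
  have comp: "compose ?X g h \<in> H" if "g \<in> H" "h \<in> H" for g h
  proof -
    have "g \<in> Bij ?X" "h \<in> Bij ?X" using that HI by (auto simp: Isom_RP_def)
    then show ?thesis using subgroup.m_closed[OF HB that] by (simp add: BijGroup_def)
  qed
  show "GAG ?X H"
  proof (cases "\<exists>g\<in>H. \<exists>X\<in>RP. g X \<noteq> X")
    case False
    have "\<one>\<^bsub>BijGroup ?X\<^esub> \<in> H" by (rule subgroup.one_closed[OF HB])
    then obtain P where "P \<in> ?X" using fp by blast
    then have "P \<in> (\<Inter>g\<in>H. Fix ?X g)" using False by (auto simp: Fix_def)
    then show ?thesis by (auto simp: GAG_def)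
  next
    case True
    then obtain g X where g: "g \<in> H" and X: "X \<in> RP" "g X \<noteq> X" by blast
    note gI = subsetD[OF HI g]
    obtain P where P: "P \<in> RP" "g P = P" using fp g by blast
    have "h P = P" if h: "h \<in> H" for h
    proof -
      note hI = subsetD[OF HI h]
      obtain Q where Q: "Q \<in> RP" "h Q = Q" using fp h by blast
      have swap: "dist_RP P Q = dist_RP Q P"
        using P(1) Q(1) by (elim RP_cases) (simp add: dist_RP_eq inner_commute)
      \<comment> \<open>If \<open>R = g (h R)\<close>, then \<open>P\<close> and \<open>Q\<close> are both equidistant from \<open>R\<close> and \<open>h R\<close>.\<close>
      obtain R where R: "R \<in> RP" "compose ?X g h R = R" using fp comp[OF g h] by blast
      then have ghR: "g (h R) = R" by (simp add: compose_eq)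
      define S where "S = h R"
      have S: "S \<in> RP" using Isom_RP_maps[OF hI R(1)] by (simp add: S_def)
      show ?thesis
      proof (cases "S = R")
        case True
        then have "g R = R" "h R = R" using ghR by (simp_all add: S_def)
        then have "R = P \<or> dist_RP R P = pi / 2"
          using RP_line_two_fixed_points[OF d gI P R(1) _ X] by blast
        moreover have "dist_RP R P = dist_RP P R"
          using P(1) R(1) by (elim RP_cases) (simp add: dist_RP_eq inner_commute)
        ultimately show ?thesis
          using RP_line_fixes_perp[OF d hI R(1) \<open>h R = R\<close> P(1)] \<open>h R = R\<close> by auto
      next
        case False
        have "dist_RP P R = dist_RP P S"
          using Isom_RP_dist[OF gI P(1) S] P ghR by (simp add: S_def)
        moreover have "dist_RP Q R = dist_RP Q S"
          using Isom_RP_dist[OF hI Q(1) R(1)] Q by (simp add: S_def)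
        ultimately have "Q = P \<or> dist_RP Q P = pi / 2"
          using RP_line_equidistant[OF d R(1) S P(1) Q(1)] False by metis
        then show ?thesis
          using RP_line_fixes_perp[OF d hI Q(1) Q(2) P(1)] Q swap by auto
      qed
    qed
    then have "P \<in> (\<Inter>g\<in>H. Fix ?X g)" using P by (auto simp: Fix_def)
    then show ?thesis by (auto simp: GAG_def)
  qed
qed

lemma fixating_mono:
  assumes "fixating X G" "subgroup G (BijGroup X)" "subgroup G' (BijGroup X)" "G' \<subseteq> G"
  shows "fixating X G'"
  unfolding fixating_def
proof (intro allI impI)
  fix H assume H: "subgroup H (BijGroup X\<lparr>carrier := G'\<rparr>)" and "GAF X H"
  interpret B: group "BijGroup X" by (rule group_BijGroup)
  have "subgroup H (BijGroup X)" by (rule B.incl_subgroup[OF assms(3) H])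
  moreover have "H \<subseteq> G" using subgroup.subset[OF H] assms(4) by auto
  ultimately have "subgroup H (BijGroup X\<lparr>carrier := G\<rparr>)"
    using B.subgroup_incl assms(2) by blast
  then show "GAG X H" using assms(1) \<open>GAF X H\<close> by (auto simp: fixating_def)
qed

lemma Isom_plus_RP_subset: "Isom_plus_RP \<subseteq> Isom_RP"
  by (auto simp: Isom_plus_RP_def Isom_plus_sphere_def rotation_matrix_def psi_in_Isom_RP)

section \<open>Groups of orthogonal matrices acting on projective space\<close>

definition projective :: "real^'d^'d \<Rightarrow> (real^'d) set \<Rightarrow> (real^'d) set" where
  "projective A = psi (restrict ((*v) A) (sphere 0 1))"

lemma projective_apply: "norm x = 1 \<Longrightarrow> projective A {x, - x} = {A *v x, - (A *v x)}"
  by (simp add: projective_def psi_eq)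

lemma orthogonal_matrix_norm:
  fixes A :: "real^'d^'d"
  assumes "orthogonal_matrix A"
  shows "norm (A *v x) = norm x"
  using assms orthogonal_transformation_matrix[of "(*v) A"] by (simp add: orthogonal_transformation)

lemma projective_mult:
  fixes A B :: "real^'d^'d"
  assumes "orthogonal_matrix A" "orthogonal_matrix B"
  shows "projective A \<otimes>\<^bsub>BijGroup RP\<^esub> projective B = projective (A ** B)"
proof -
  have "compose RP (projective A) (projective B) P = projective (A ** B) P" for P
  proof (cases "P \<in> RP")
    case True
    then show ?thesis using assms
      by (elim RP_cases)
         (simp add: compose_eq RP_I projective_apply orthogonal_matrix_norm matrix_vector_mul_assoc)
  qed (simp add: compose_def projective_def psi_def)
  moreover have "projective A \<in> Bij RP" "projective B \<in> Bij RP"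
    using assms psi_in_Isom_RP by (auto simp: projective_def Isom_RP_def)
  ultimately show ?thesis by (auto simp: BijGroup_def)
qed

lemma projective_one: "projective (mat 1 :: real^'d^'d) = \<one>\<^bsub>BijGroup RP\<^esub>"
proof
  show "projective (mat 1) P = \<one>\<^bsub>BijGroup RP\<^esub> P" for P :: "(real^'d) set"
  proof (cases "P \<in> RP")
    case True
    then show ?thesis by (elim RP_cases) (simp add: BijGroup_def projective_apply RP_I)
  qed (simp add: BijGroup_def projective_def psi_def)
qed

text \<open>A fixed point of the projective map of an orthogonal matrix is a line of eigenvectors, and the
  eigenvalue must be \<open>1\<close> or \<open>-1\<close>. This turns the two fixed-point conditions into linear algebra.\<close>

theorem not_fixating_by_matrices:
  fixes \<A> :: "(real^'d^'d) set"
  assumes G: "subgroup G (BijGroup RP)" "projective ` \<A> \<subseteq> G"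
    and orth: "\<And>A. A \<in> \<A> \<Longrightarrow> orthogonal_matrix A"
    and one: "mat 1 \<in> \<A>"
    and mult: "\<And>A B. A \<in> \<A> \<Longrightarrow> B \<in> \<A> \<Longrightarrow> A ** B \<in> \<A>"
    and tr: "\<And>A. A \<in> \<A> \<Longrightarrow> transpose A \<in> \<A>"
    and eigen: "\<And>A. A \<in> \<A> \<Longrightarrow> \<exists>x. x \<noteq> 0 \<and> A *v x \<in> {x, - x}"
    and no_common: "\<And>x. x \<noteq> 0 \<Longrightarrow> \<exists>A\<in>\<A>. A *v x \<notin> {x, - x}"
  shows "\<not> fixating RP G"
proof
  assume G_fixating: "fixating RP G"
  interpret B: group "BijGroup (RP :: (real^'d) set set)" by (rule group_BijGroup)
  let ?H = "projective ` \<A>"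
  have car: "projective A \<in> carrier (BijGroup RP)" if "A \<in> \<A>" for A
    using orth[OF that] psi_in_Isom_RP[of A] by (simp add: projective_def Isom_RP_def BijGroup_def)
  have "subgroup ?H (BijGroup RP)"
  proof (rule B.subgroupI)
    show "?H \<subseteq> carrier (BijGroup RP)" using car by auto
    show "?H \<noteq> {}" using one by auto
  next
    fix g assume "g \<in> ?H"
    then obtain A where A: "A \<in> \<A>" "g = projective A" by auto
    have "projective (transpose A) \<otimes>\<^bsub>BijGroup RP\<^esub> projective A = \<one>\<^bsub>BijGroup RP\<^esub>"
      using orth[OF A(1)] orth[OF tr[OF A(1)]]
      by (simp add: projective_mult projective_one[symmetric]) (simp add: orthogonal_matrix_def)
    then have "inv\<^bsub>BijGroup RP\<^esub> g = projective (transpose A)"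
      using car A tr by (intro B.inv_equality) auto
    then show "inv\<^bsub>BijGroup RP\<^esub> g \<in> ?H" using A tr by auto
  next
    fix g h assume "g \<in> ?H" "h \<in> ?H"
    then show "g \<otimes>\<^bsub>BijGroup RP\<^esub> h \<in> ?H"
      using mult orth by (auto simp: projective_mult)
  qed
  then have "subgroup ?H (BijGroup RP\<lparr>carrier := G\<rparr>)"
    using B.subgroup_incl G by blast
  moreover have "GAF RP ?H"
  proof -
    have "Fix RP (projective A) \<noteq> {}" if A: "A \<in> \<A>" for A
    proof -
      obtain x where x: "x \<noteq> 0" "A *v x \<in> {x, - x}" using eigen[OF A] by blast
      define y where "y = (1 / norm x) *\<^sub>R x"
      have y: "norm y = 1" using x by (simp add: y_def)
      have Ay: "A *v y = (1 / norm x) *\<^sub>R (A *v x)"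
        by (simp only: y_def matrix_vector_mult_scaleR)
      have "projective A {y, - y} = {y, - y}"
      proof (cases "A *v x = x")
        case True
        then have "A *v y = y" unfolding Ay by (simp only: y_def)
        then show ?thesis by (simp only: projective_apply[OF y])
      next
        case False
        then have "A *v x = - x" using x(2) by simp
        then have "A *v y = - y" unfolding Ay by (simp only: y_def scaleR_minus_right)
        then show ?thesis unfolding projective_apply[OF y] by (simp only: minus_minus insert_commute)
      qed
      then show ?thesis using RP_I[OF y] by (auto simp: Fix_def)
    qed
    then show ?thesis by (simp add: GAF_def)
  qed
  ultimately have "GAG RP ?H" using G_fixating by (simp add: fixating_def)
  then obtain P where P: "\<And>A. A \<in> \<A> \<Longrightarrow> P \<in> Fix RP (projective A)" by (auto simp: GAG_def)
  then have "P \<in> RP" using one by (auto simp: Fix_def)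
  then obtain x where x: "norm x = 1" "P = {x, - x}" by (rule RP_cases)
  then have "x \<noteq> 0" by auto
  then obtain A where A: "A \<in> \<A>" "A *v x \<notin> {x, - x}" using no_common by blast
  have "projective A {x, - x} = {x, - x}" using P[OF A(1)] x by (simp add: Fix_def)
  then show False using A(2) projective_apply[OF x(1), of A] by auto
qed

section \<open>Signed permutation matrices\<close>

definition signed_perm :: "('d \<Rightarrow> real) \<Rightarrow> ('d \<Rightarrow> 'd) \<Rightarrow> real^'d^'d" where
  "signed_perm s p = (\<chi> i j. if j = p i then s i else 0)"

lemma signed_perm_apply: "(signed_perm s p *v v) $ i = s i * v $ p i"
  by (simp add: signed_perm_def matrix_vector_mult_def if_distrib[of "\<lambda>c. c * _"] cong: if_cong)

lemma orthogonal_signed_perm: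
  assumes p: "p permutes UNIV" and s: "\<And>i. \<bar>s i\<bar> = 1"
  shows "orthogonal_matrix (signed_perm s p)"
proof -
  have "norm (signed_perm s p *v v) = norm v" for v
  proof -
    have "s i * s i = 1" for i using s[of i] by (metis abs_mult_self_eq mult_1)
    then have "(s i * v $ p i)\<^sup>2 = (v $ p i)\<^sup>2" for i by (simp add: power_mult_distrib power2_eq_square)
    then have "(\<Sum>i\<in>UNIV. (s i * v $ p i)\<^sup>2) = (\<Sum>i\<in>UNIV. (v $ i)\<^sup>2)"
      using sum.permute[OF p, of "\<lambda>i. (v $ i)\<^sup>2"] by (simp add: comp_def)
    then show ?thesis by (simp add: norm_vec_def L2_set_def signed_perm_apply)
  qed
  then have "orthogonal_transformation ((*v) (signed_perm s p))"
    by (simp add: orthogonal_transformation)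
  then show ?thesis by (simp add: orthogonal_transformation_matrix)
qed

text \<open>The rows of the matrix are those of a diagonal matrix, permuted by \<open>p\<close>.\<close>

lemma det_signed_perm:
  assumes p: "p permutes (UNIV :: 'd::finite set)"
  shows "det (signed_perm s p :: real^'d^'d) = of_int (sign p) * (\<Prod>i\<in>UNIV. s i)"
proof -
  let ?E = "(\<chi> k j. if j = k then s (inv_into UNIV p k) else 0) :: real^'d^'d"
  have "signed_perm s p = (\<chi> i. ?E $ p i)"
    using permutes_inverses[OF p] by (simp add: signed_perm_def vec_eq_iff)
  then have "det (signed_perm s p) = of_int (sign p) * det ?E"
    using det_permute_rows[OF p, of ?E] by simp
  also have "det ?E = (\<Prod>k\<in>UNIV. s (inv_into UNIV p k))"
    by (subst det_diagonal) auto
  also have "\<dots> = (\<Prod>i\<in>UNIV. s i)"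
    using prod.permute[OF permutes_inv[OF p], of s] by (simp add: comp_def)
  finally show ?thesis .
qed

section \<open>Commutation up to a factor\<close>

text \<open>Groups of matrices are cut out by commutation relations with fixed matrices, so that closure
  under products and transposes is automatic. The factor \<open>c = -1\<close> is of interest
  because the projective maps commute in that case as well.\<close>

definition twisted :: "real \<Rightarrow> real^'d^'d \<Rightarrow> real^'d^'d \<Rightarrow> bool" where
  "twisted c A K \<longleftrightarrow> (\<forall>v. A *v (K *v v) = c *\<^sub>R (K *v (A *v v)))"

lemma twisted_one: "twisted 1 (mat 1) K"
  by (simp add: twisted_def)

lemma twisted_mult:
  assumes "twisted c A K" "twisted e B K"
  shows "twisted (c * e) (A ** B) K"
  using assms by (simp add: twisted_def matrix_vector_mul_assoc[symmetric] matrix_vector_mult_scaleR mult.commute)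

lemma twisted_transpose:
  assumes A: "orthogonal_matrix A" and "twisted c A K" "c * c = 1"
  shows "twisted c (transpose A) K"
  unfolding twisted_def
proof
  fix v
  let ?T = "transpose A"
  have AT: "A *v (?T *v w) = w" and TA: "?T *v (A *v w) = w" for w
    using A by (simp_all add: matrix_vector_mul_assoc orthogonal_matrix_def del: transpose_matrix_vector)
  have "A *v (K *v (?T *v v)) = c *\<^sub>R (K *v v)"
    using assms(2) by (simp add: twisted_def AT del: transpose_matrix_vector)
  then have "?T *v (A *v (K *v (?T *v v))) = c *\<^sub>R (?T *v (K *v v))"
    by (simp add: matrix_vector_mult_scaleR del: transpose_matrix_vector)
  then have "c *\<^sub>R (K *v (?T *v v)) = (c * c) *\<^sub>R (?T *v (K *v v))"
    by (simp add: TA del: transpose_matrix_vector)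
  then show "?T *v (K *v v) = c *\<^sub>R (K *v (?T *v v))" using assms(3) by (simp del: transpose_matrix_vector)
qed

lemma orthogonal_eigenvalue:
  fixes A :: "real^'d^'d"
  assumes "orthogonal_matrix A" "A *v x = c *\<^sub>R x" "x \<noteq> 0"
  shows "A *v x \<in> {x, - x}"
proof -
  have "\<bar>c\<bar> * norm x = norm x" using orthogonal_matrix_norm[OF assms(1), of x] assms(2) by simp
  then have "c = 1 \<or> c = - 1" using assms(3) by auto
  then show ?thesis using assms(2) by auto
qed

section \<open>Projective space of dimension three\<close>

text \<open>With coordinates \<open>(a, b, c, d)\<close>, the matrices are \<open>K (a, b, c, d) = (a, -b, -d, c)\<close> and
  \<open>M (a, b, c, d) = (b, a, d, c)\<close>. They satisfy \<open>K M = - M K\<close>, so they belong to the group that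
  they define.\<close>

theorem not_fixating_Isom_RP_3:
  assumes d: "CARD('d::finite) = 4"
  shows "\<not> fixating (RP :: (real^'d) set set) Isom_RP"
proof -
  obtain xs :: "'d list" where xs: "distinct xs" "set xs = UNIV"
    using finite_distinct_list[of "UNIV :: 'd set"] by auto
  then have "length xs = 4" using d distinct_card by metis
  then obtain i j k l where "xs = [i, j, k, l]"
    by (auto simp: numeral_eq_Suc length_Suc_conv)
  with xs have U: "UNIV = {i, j, k, l}" and dist: "distinct [i, j, k, l]" by auto
  have ext: "v = w \<longleftrightarrow> v$i = w$i \<and> v$j = w$j \<and> v$k = w$k \<and> v$l = w$l" for v w :: "real^'d"
  proof -
    have "(\<forall>m\<in>UNIV. v$m = w$m) \<longleftrightarrow> v$i = w$i \<and> v$j = w$j \<and> v$k = w$k \<and> v$l = w$l"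
      unfolding U by simp
    then show ?thesis by (simp add: vec_eq_iff)
  qed
  define K :: "real^'d^'d" where
    "K = signed_perm (\<lambda>m. if m = j \<or> m = k then - 1 else 1) (Transposition.transpose k l)"
  define M :: "real^'d^'d" where
    "M = signed_perm (\<lambda>m. 1) (Transposition.transpose i j \<circ> Transposition.transpose k l)"
  have K: "(K *v v) $ i = v $ i" "(K *v v) $ j = - v $ j" "(K *v v) $ k = - v $ l" "(K *v v) $ l = v $ k" for v
    using dist by (auto simp: K_def signed_perm_apply Transposition.transpose_def)
  have M: "(M *v v) $ i = v $ j" "(M *v v) $ j = v $ i" "(M *v v) $ k = v $ l" "(M *v v) $ l = v $ k" for v
    using dist by (auto simp: M_def signed_perm_apply Transposition.transpose_def)
  have oK: "orthogonal_matrix K" unfolding K_def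
    by (rule orthogonal_signed_perm) (auto simp: permutes_swap_id)
  have oM: "orthogonal_matrix M" unfolding M_def
    by (rule orthogonal_signed_perm) (auto intro!: permutes_compose simp: permutes_swap_id)
  let ?S = "{1, - 1 :: real}"
  define \<A> where "\<A> = {A. orthogonal_matrix A \<and> (\<exists>c\<in>?S. twisted c A K) \<and> (\<exists>c\<in>?S. twisted c A M)}"
  show ?thesis
  proof (rule not_fixating_by_matrices[where \<A> = \<A>])
    show "subgroup Isom_RP (BijGroup (RP :: (real^'d) set set))" by (rule subgroup_Isom_RP)
    show "projective ` \<A> \<subseteq> Isom_RP" by (auto simp: \<A>_def projective_def psi_in_Isom_RP)
    show "orthogonal_matrix A" if "A \<in> \<A>" for A using that by (simp add: \<A>_def)
    show "mat 1 \<in> \<A>" by (auto simp: \<A>_def orthogonal_matrix_id twisted_one)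
    have S: "c * e \<in> ?S" if "c \<in> ?S" "e \<in> ?S" for c e using that by auto
    show "A ** B \<in> \<A>" if "A \<in> \<A>" "B \<in> \<A>" for A B
      using that unfolding \<A>_def mem_Collect_eq
      by (meson S orthogonal_matrix_mul twisted_mult)
    show "transpose A \<in> \<A>" if "A \<in> \<A>" for A
    proof -
      have "c * c = 1" if "c \<in> ?S" for c using that by auto
      with that show ?thesis unfolding \<A>_def mem_Collect_eq
        by (metis orthogonal_matrix_transpose twisted_transpose)
    qed
    show "\<exists>x. x \<noteq> 0 \<and> A *v x \<in> {x, - x}" if "A \<in> \<A>" for A
    proof -
      from that have oA: "orthogonal_matrix A" by (simp add: \<A>_def)
      from that obtain c e where ce: "c \<in> ?S" "e \<in> ?S" and t: "twisted c A K" "twisted e A M"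
        by (auto simp: \<A>_def)
      have AK: "A *v (K *v v) = c *\<^sub>R (K *v (A *v v))" and AM: "A *v (M *v v) = e *\<^sub>R (M *v (A *v v))" for v
        using t by (auto simp: twisted_def)
      have neg: "K *v (- v) = - (K *v v)" for v
        using linear_neg[OF matrix_vector_mul_linear] by blast
      consider "c = 1" | "c = - 1" "e = 1" | "c = - 1" "e = - 1" using ce by auto
      then show ?thesis
      proof cases
        \<comment> \<open>\<open>A\<close> commutes with \<open>K\<close>, whose eigenspace for \<open>1\<close> is the first axis.\<close>
        case 1
        define u :: "real^'d" where "u = axis i 1"
        have u: "u$i = 1" "u$j = 0" "u$k = 0" "u$l = 0" using dist by (auto simp: u_def axis_def)
        have "K *v u = u" by (simp add: ext K u)
        then have "K *v (A *v u) = A *v u" using AK[of u] 1 by simp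
        then have "A *v u = (A *v u)$i *\<^sub>R u" by (simp add: ext K u)
        then show ?thesis using orthogonal_eigenvalue[OF oA] u by (metis zero_index zero_neq_one)
      next
        \<comment> \<open>\<open>A\<close> commutes with \<open>M\<close> and \<open>K\<^sup>2\<close>; both are the identity only on the line of \<open>(1, 1, 0, 0)\<close>.\<close>
        case 2
        define u :: "real^'d" where "u = axis i 1 + axis j 1"
        have u: "u$i = 1" "u$j = 1" "u$k = 0" "u$l = 0" using dist by (auto simp: u_def axis_def)
        have "M *v u = u" "K *v (K *v u) = u" by (simp_all add: ext K M u)
        then have MA: "M *v (A *v u) = A *v u" and KA: "K *v (K *v (A *v u)) = A *v u"
          using AM[of u] AK[of u] AK[of "K *v u"] 2 by (simp_all add: neg)
        have "(A *v u)$j = (A *v u)$i" using M(1)[of "A *v u"] by (simp add: MA)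
        moreover have "(A *v u)$k = 0" using K(3)[of "K *v (A *v u)"] K(4)[of "A *v u"] by (simp add: KA)
        moreover have "(A *v u)$l = 0" using K(4)[of "K *v (A *v u)"] K(3)[of "A *v u"] by (simp add: KA)
        ultimately have "A *v u = (A *v u)$i *\<^sub>R u" by (simp add: ext u)
        then show ?thesis using orthogonal_eigenvalue[OF oA] u by (metis zero_index zero_neq_one)
      next
        \<comment> \<open>The two signs cancel: \<open>A\<close> commutes with \<open>K M\<close>, which fixes only the last axis pointwise.\<close>
        case 3
        define u :: "real^'d" where "u = axis l 1"
        have u: "u$i = 0" "u$j = 0" "u$k = 0" "u$l = 1" using dist by (auto simp: u_def axis_def)
        have "K *v (M *v u) = u" by (simp add: ext K M u)
        then have "K *v (M *v (A *v u)) = A *v u"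
          using AM[of u] AK[of "M *v u"] 3 by (simp add: neg)
        then have "A *v u = (A *v u)$l *\<^sub>R u" by (simp add: ext K M u)
        then show ?thesis using orthogonal_eigenvalue[OF oA] u by (metis zero_index zero_neq_one)
      qed
    qed
    show "\<exists>A\<in>\<A>. A *v x \<notin> {x, - x}" if "x \<noteq> 0" for x
    proof (rule ccontr)
      assume no: "\<not> ?thesis"
      have "twisted (- 1) K M" "twisted (- 1) M K" "twisted 1 K K" "twisted 1 M M"
        by (auto simp: twisted_def ext K M)
      then have "K \<in> \<A>" "M \<in> \<A>" using oK oM by (auto simp: \<A>_def)
      with no have "K *v x = x \<or> K *v x = - x" "M *v x = x \<or> M *v x = - x" by auto
      then obtain a b :: real where a: "a = 1 \<or> a = - 1" "K *v x = a *\<^sub>R x"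
        and b: "b = 1 \<or> b = - 1" "M *v x = b *\<^sub>R x"
        by (metis scaleR_minus1_left scaleR_one)
      have "x$i = a * x$i" "- x$j = a * x$j" "- x$l = a * x$k" "x$k = a * x$l" "x$j = b * x$i"
        using K[of x] M(1)[of x] unfolding a(2) b(2) vector_scaleR_component real_scaleR_def
        by linarith+
      with a(1) b(1) have "x$i = 0" "x$j = 0" "x$k = 0" "x$l = 0"
        by (elim disjE; hypsubst; linarith)+
      then have "x = 0" by (simp add: ext)
      with that show False by simp
    qed
  qed
qed

section \<open>Rotations preserving an odd number of coordinates\<close>

text \<open>From \<open>C + 1 = C (C + 1)\<^sup>T\<close> one gets \<open>det (C + 1) = det C * det (C + 1) = - det (C + 1)\<close>.\<close>

lemma eigenvector_minus_one:
  fixes C :: "real^'d^'d"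
  assumes C: "orthogonal_matrix C" and "det C = - 1"
  obtains v where "v \<noteq> 0" "C *v v = - v"
proof -
  have "C + mat 1 = C ** transpose (C + mat 1)"
  proof -
    have "transpose (C + mat 1) = transpose C + mat 1"
      by (auto simp: vec_eq_iff transpose_def mat_def)
    then show ?thesis using C by (simp add: matrix_add_ldistrib orthogonal_matrix_def add.commute)
  qed
  then have "det (C + mat 1) = - det (C + mat 1)"
    using assms(2) det_mul[of C "transpose (C + mat 1)"] by simp
  then have "\<not> invertible (C + mat 1)" by (simp add: invertible_det_nz)
  then obtain v where "v \<noteq> 0" "(C + mat 1) *v v = 0"
    by (auto simp: invertible_left_inverse matrix_left_invertible_ker)
  then show thesis
    using that[of v] by (simp add: matrix_vector_mult_add_rdistrib eq_neg_iff_add_eq_0)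
qed

definition reverse :: "'d set \<Rightarrow> real^'d^'d" where
  "reverse S = signed_perm (\<lambda>i. if i \<in> S then - 1 else 1) id"

lemma reverse_apply: "(reverse S *v v) $ i = (if i \<in> S then - v $ i else v $ i)"
  by (simp add: reverse_def signed_perm_apply)

lemma orthogonal_reverse: "orthogonal_matrix (reverse S)"
  unfolding reverse_def by (rule orthogonal_signed_perm) (auto simp: permutes_id)

lemma det_reverse: "det (reverse S :: real^'d^'d) = (- 1) ^ card S"
proof -
  have "(\<Prod>i\<in>UNIV. if i \<in> S then - 1 else (1::real)) = (\<Prod>i\<in>S. - 1)"
    by (rule prod.mono_neutral_cong_right) auto
  then show ?thesis by (simp add: reverse_def det_signed_perm permutes_id sign_id)
qed

text \<open>Let \<open>pr\<close> be the projection onto the coordinates in \<open>S\<close>, which \<open>A\<close> preserves. For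
  \<open>\<epsilon> = 1\<close> and \<open>\<epsilon> = -1\<close> the map that is \<open>\<epsilon> A\<close> on the range of \<open>pr\<close> and the identity on its kernel
  is orthogonal. The two maps differ by the sign change of the coordinates in \<open>S\<close>, whose
  determinant is \<open>-1\<close>, so one of them has determinant \<open>-1\<close> and hence the eigenvalue \<open>-1\<close>. An
  eigenvector for it must lie in the range of \<open>pr\<close>, where it is an eigenvector of \<open>A\<close>.\<close>

lemma odd_block_eigenvector:
  fixes A :: "real^'d^'d"
  assumes A: "orthogonal_matrix A" and t: "twisted 1 A (reverse S)" and S: "odd (card S)"
  obtains v where "v \<noteq> 0" "A *v v \<in> {v, - v}"
proof -
  define pr where "pr v = (\<chi> i. if i \<in> S then v $ i else 0)" for v :: "real^'d"
  have pr_eq: "pr v = (1/2) *\<^sub>R (v - reverse S *v v)" for v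
    by (simp add: pr_def vec_eq_iff reverse_apply)
  have comm: "A *v pr v = pr (A *v v)" for v
    using t by (simp add: pr_eq twisted_def matrix_vector_mult_scaleR matrix_vector_mult_diff_distrib)
  have lin: "linear pr"
    by (rule linearI) (auto simp: pr_def vec_eq_iff)
  have idem: "pr (pr v) = pr v" for v by (simp add: pr_def vec_eq_iff)
  have perp: "pr v \<bullet> (w - pr w) = 0" for v w
    by (auto simp: pr_def inner_vec_def intro!: sum.neutral)
  define F where "F v = A *v pr v + (v - pr v)" for v
  have linF: "linear F"
    unfolding F_def
    by (intro linear_compose_add linear_compose_sub lin linear_id[unfolded id_def]
        linear_compose[OF lin matrix_vector_mul_linear, unfolded comp_def])
  have normF: "norm (F v) = norm v" for v
  proof -
    have "orthogonal (A *v pr v) (v - pr v)"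
      using perp[of "A *v v" v] by (simp add: orthogonal_def comm)
    then have "(norm (F v))\<^sup>2 = (norm (pr v))\<^sup>2 + (norm (v - pr v))\<^sup>2"
      unfolding F_def by (simp add: norm_add_Pythagorean orthogonal_matrix_norm[OF A])
    also have "\<dots> = (norm (pr v + (v - pr v)))\<^sup>2"
      by (rule norm_add_Pythagorean[symmetric]) (simp add: orthogonal_def perp)
    finally show ?thesis by simp
  qed
  define C where "C = matrix F"
  have CF: "C *v v = F v" for v by (simp add: C_def linF matrix_works)
  have C: "orthogonal_matrix C"
    using linF normF orthogonal_transformation_matrix[of F] by (simp add: C_def orthogonal_transformation)
  have pr_rev: "pr (reverse S *v v) = - pr v" "reverse S *v v - pr (reverse S *v v) = v - pr v" for v
    by (auto simp: pr_def vec_eq_iff reverse_apply)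
  have Aneg: "A *v (- v) = - (A *v v)" for v
    using linear_neg[OF matrix_vector_mul_linear] by blast
  consider "det C = - 1" | "det (C ** reverse S) = - 1"
    using det_orthogonal_matrix[OF C] S by (auto simp: det_mul det_reverse)
  then obtain \<epsilon> v where v: "v \<noteq> 0" and \<epsilon>: "\<epsilon> \<in> {1, - 1 :: real}"
    and Fv: "\<epsilon> *\<^sub>R (A *v pr v) + (v - pr v) = - v"
  proof cases
    case 1
    then obtain v where "v \<noteq> 0" "C *v v = - v" using eigenvector_minus_one[OF C] by blast
    then show thesis using that[of v 1] by (simp add: CF F_def)
  next
    case 2
    then obtain v where v: "v \<noteq> 0" "(C ** reverse S) *v v = - v"
      using eigenvector_minus_one[OF orthogonal_matrix_mul[OF C orthogonal_reverse]] by blast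
    then have "F (reverse S *v v) = - v" by (simp add: matrix_vector_mul_assoc[symmetric] CF)
    then show thesis using that[of v "- 1"] v(1) unfolding F_def pr_rev(2) by (simp add: pr_rev(1) Aneg)
  qed
  have "pr (\<epsilon> *\<^sub>R (A *v pr v) + (v - pr v)) = \<epsilon> *\<^sub>R (A *v pr v)"
    by (simp add: linear_add[OF lin] linear_diff[OF lin] linear_scale[OF lin] comm idem)
  then have "\<epsilon> *\<^sub>R (A *v pr v) = - pr v" unfolding Fv by (simp add: linear_neg[OF lin])
  moreover from this Fv have "v - pr v = - (v - pr v)" by (simp add: algebra_simps)
  then have "2 *\<^sub>R (v - pr v) = 0" unfolding scaleR_2 by (simp only: eq_neg_iff_add_eq_0)
  then have "pr v = v" by simp
  ultimately show thesis using that[OF v] \<epsilon> by auto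
qed

text \<open>A block of size three is the smallest odd one without an invariant line for its rotations. The
  complementary block is empty or has at least two coordinates, since the total is not four.\<close>

theorem not_fixating_Isom_plus_RP:
  assumes d: "CARD('d::finite) \<ge> 3" "CARD('d) \<noteq> 4"
  shows "\<not> fixating (RP :: (real^'d) set set) Isom_plus_RP"
proof -
  obtain S :: "'d set" where S: "card S = 3" using obtain_subset_with_card_n[OF d(1)] by metis
  have cS: "card (- S) = CARD('d) - 3" using S by (simp add: Compl_eq_Diff_UNIV card_Diff_subset)
  define \<A> where "\<A> = {A :: real^'d^'d. rotation_matrix A \<and> twisted 1 A (reverse S)}"
  have rev_in: "reverse {i, j} \<in> \<A>" if "i \<noteq> j" for i j
    using that by (auto simp: \<A>_def rotation_matrix_def orthogonal_reverse det_reverse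
        twisted_def vec_eq_iff reverse_apply)
  show ?thesis
  proof (rule not_fixating_by_matrices[where \<A> = \<A>])
    show "subgroup Isom_plus_RP (BijGroup (RP :: (real^'d) set set))" by (rule subgroup_Isom_plus_RP)
    show "projective ` \<A> \<subseteq> Isom_plus_RP"
      by (auto simp: \<A>_def projective_def Isom_plus_RP_def Isom_plus_sphere_def)
    show "orthogonal_matrix A" if "A \<in> \<A>" for A
      using that by (simp add: \<A>_def rotation_matrix_def)
    show "mat 1 \<in> \<A>"
      by (simp add: \<A>_def rotation_matrix_def orthogonal_matrix_id twisted_one)
    show "A ** B \<in> \<A>" if "A \<in> \<A>" "B \<in> \<A>" for A B
      using that twisted_mult[of 1 A _ 1 B]
      by (simp add: \<A>_def rotation_matrix_def orthogonal_matrix_mul det_mul)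
    show "transpose A \<in> \<A>" if "A \<in> \<A>" for A
      using that twisted_transpose[of A 1]
      by (simp add: \<A>_def rotation_matrix_def)
    show "\<exists>x. x \<noteq> 0 \<and> A *v x \<in> {x, - x}" if "A \<in> \<A>" for A
    proof -
      have "orthogonal_matrix A" "twisted 1 A (reverse S)"
        using that by (simp_all add: \<A>_def rotation_matrix_def)
      then show ?thesis using odd_block_eigenvector[of A S] S by auto
    qed
    show "\<exists>A\<in>\<A>. A *v x \<notin> {x, - x}" if x: "x \<noteq> 0" for x
    proof -
      obtain i where i: "x $ i \<noteq> 0" using x by (auto simp: vec_eq_iff)
      show ?thesis
      proof (cases "\<exists>j. j \<noteq> i \<and> x $ j \<noteq> 0")
        \<comment> \<open>Reversing coordinate \<open>i\<close> but not \<open>j\<close>; the third coordinate \<open>k\<close> keeps the determinant \<open>1\<close>.\<close>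
        case True
        then obtain j where j: "j \<noteq> i" "x $ j \<noteq> 0" by blast
        have "\<not> UNIV \<subseteq> {i, j}" using card_mono[of "{i, j}" UNIV] d(1) j(1) by auto
        then obtain k where k: "k \<noteq> i" "k \<noteq> j" by auto
        have "(reverse {i, k} *v x) $ i = - x $ i" "(reverse {i, k} *v x) $ j = x $ j"
          using j k by (simp_all add: reverse_apply)
        then have "reverse {i, k} *v x \<notin> {x, - x}" using i j by auto
        then show ?thesis using rev_in k by metis
      next
        \<comment> \<open>A quarter turn moves the axis \<open>i\<close> to another axis \<open>j\<close> of the same block.\<close>
        case False
        have "\<exists>j. j \<noteq> i \<and> (j \<in> S \<longleftrightarrow> i \<in> S)"
        proof (rule ccontr)
          assume no: "\<not> ?thesis"
          show False
          proof (cases "i \<in> S")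
            case True
            with no have "S = {i}" by auto
            with S show False by simp
          next
            case False
            with no have "- S = {i}" by auto
            with cS d show False by simp
          qed
        qed
        then obtain j where j: "j \<noteq> i" "j \<in> S \<longleftrightarrow> i \<in> S" by blast
        define A :: "real^'d^'d" where
          "A = signed_perm (\<lambda>m. if m = i then - 1 else 1) (Transposition.transpose i j)"
        have "A \<in> \<A>"
          unfolding \<A>_def mem_Collect_eq
        proof
          have "(\<Prod>m\<in>UNIV. if m = i then - 1 else (1::real)) = - 1" by (simp add: prod.delta)
          then have "det A = 1" using j(1)
            by (simp add: A_def det_signed_perm permutes_swap_id sign_swap_id)
          then show "rotation_matrix A"
            by (auto simp: rotation_matrix_def A_def permutes_swap_id intro!: orthogonal_signed_perm)
          show "twisted 1 A (reverse S)" using j(2)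
            by (auto simp: twisted_def vec_eq_iff A_def signed_perm_apply reverse_apply Transposition.transpose_def)
        qed
        moreover have "x $ j = 0" using False j(1) by blast
        then have "(A *v x) $ i = 0" by (simp add: A_def signed_perm_apply)
        then have "A *v x \<notin> {x, - x}" using i by auto
        ultimately show ?thesis by blast
      qed
    qed
  qed
qed

section \<open>The classification\<close>

theorem theorem5p21:
  fixes n :: nat
  assumes "n \<ge> 1" and "CARD('d::finite) = n + 1"
  shows "(fixating (RP :: (real^'d) set set) Isom_RP \<longleftrightarrow> n = 1) \<and>
    (n = 1 \<longrightarrow> fixating (RP :: (real^'d) set set) Isom_plus_RP) \<and>
    (odd n \<and> n \<ge> 5 \<longrightarrow> \<not> fixating (RP :: (real^'d) set set) Isom_plus_RP)"
proof -
  let ?X = "RP :: (real^'d) set set"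
  have mono: "fixating ?X Isom_plus_RP" if "fixating ?X Isom_RP"
    using fixating_mono[OF that subgroup_Isom_RP subgroup_Isom_plus_RP Isom_plus_RP_subset] .
  have line: "fixating ?X Isom_RP" if "n = 1"
    by (rule fixating_Isom_RP_line) (use assms(2) that in simp)
  have plus: "\<not> fixating ?X Isom_plus_RP" if "n \<ge> 2" "n \<noteq> 3"
    by (rule not_fixating_Isom_plus_RP) (use assms(2) that in simp_all)
  have three: "\<not> fixating ?X Isom_RP" if "n = 3"
    by (rule not_fixating_Isom_RP_3) (use assms(2) that in simp)
  have "n = 1" if "fixating ?X Isom_RP"
  proof (rule ccontr)
    assume "n \<noteq> 1"
    then have "n \<ge> 2" using assms(1) by simp
    with mono[OF that] plus three that show False by blast
  qed
  with line mono plus show ?thesis by auto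
qed

end
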